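(* Let $S=F_D\cup F\cup\Lambda_{I,p,d}\cup\Sigma_{p,d,P}$ be a two-sided subsemigroup (of the first form) of the bicyclic monoid $\mathcal{B}$, with $S\ne\mathcal{B}$. Then $S$ is a left I-order in $\mathcal{B}$ if and only if $R_1\subseteq S$.
   Context: The bicyclic monoid $\mathcal{B}$ is the monoid generated by $a,b$ subject to $ba=1$; its elements are uniquely of the form $a^ib^j$ with $i,j\ge 0$, with $a^kb^l\,a^mb^n=a^{k-l+t}b^{n-m+t}$ where $t=\max\{l,m\}$. It is an inverse monoid with $(a^ib^j)^{-1}=a^jb^i$. A subsemigroup $S$ of an inverse semigroup $Q$ is a left I-order in $Q$ if every element of $Q$ can be written as $s^{-1}t$ with $s,t\in S$. $R_1=\{a^0b^j : j\ge 0\}$ is the $\mathcal{R}$-class of the identity. Notation: $\mathbb{N}$ is the set of positive integers, $\mathbb{N}^0=\mathbb{N}\cup\{0\}$; $D=\{a^ib^i: i\ge 0\}$; $L^q=\{a^ib^j: 0\le j\le q,\ i\ge 0\}$; $T_{q,p}=\{a^ib^j : q\le i\le j<p\}$; $\Lambda_{I,p,d}=\{a^ib^j : i\in I,\ d\mid j-i,\ j\ge p\}$; $\Sigma_{p,d,P}=\{a^{p+r+ud}b^{p+r+vd} : r\in P,\ u,v\ge 0\}$. A two-sided subsemigroup of the first form is a subsemigroup $S=F_D\cup F\cup\Lambda_{I,p,d}\cup\Sigma_{p,d,P}$ of $\mathcal{B}$, where $q,p\in\mathbb{N}^0$ with $q\le p$, $d\in\mathbb{N}$, $I\subseteq\{q,\dots,p-1\}$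 with $q\in I$, $P\subseteq\{0,\dots,d-1\}$ with $0\in P$, $F_D\subseteq D\cap L^q$ and $F\subseteq T_{q,p}$. *)

theory Defs
  imports Main
begin

section \<open>Inverse semigroups and left I-orders\<close>

class inverse_semigroup = semigroup_mult +
  assumes ex1_semigroup_inverse: "\<exists>!y. x * y * x = x \<and> y * x * y = y"
begin

definition sinv :: "'a \<Rightarrow> 'a" where
  "sinv x = (THE y. x * y * x = x \<and> y * x * y = y)"

end

definition subsemigroup :: "'a::semigroup_mult set \<Rightarrow> bool" where
  "subsemigroup S \<longleftrightarrow> S \<noteq> {} \<and> (\<forall>x\<in>S. \<forall>y\<in>S. x * y \<in> S)"

definition left_I_order :: "'a::inverse_semigroup set \<Rightarrow> bool" where
  "left_I_order S \<longleftrightarrow> subsemigroup S \<and> (\<forall>x. \<exists>s\<in>S. \<exists>t\<in>S. x = sinv s * t)"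


section \<open>The bicyclic monoid\<close>

text \<open>The elements are the normal forms: \<open>AB i j\<close> stands for \<open>a\<^sup>i b\<^sup>j\<close>. The lemmas
  \<open>gen_b_gen_a\<close>, \<open>AB_eq\<close> and \<open>bicyclic_presentation\<close> below confirm that this is the monoid
  presented by generators \<open>a, b\<close> and the relation \<open>b a = 1\<close>.\<close>

datatype bicyclic = AB nat nat

text \<open>With \<open>t = max l m\<close> the natural number subtractions \<open>t - l\<close> and \<open>t - m\<close> never truncate.\<close>

instantiation bicyclic :: monoid_mult
begin

definition one_bicyclic :: bicyclic where
  "1 = AB 0 0"

fun times_bicyclic :: "bicyclic \<Rightarrow> bicyclic \<Rightarrow> bicyclic" where
  "AB k l * AB m n = AB (k + (max l m - l)) (n + (max l m - m))"

instance
proof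
  fix x y z :: bicyclic
  show "x * y * z = x * (y * z)"
    by (cases x; cases y; cases z) (auto simp: max_def)
  show "1 * x = x" "x * 1 = x"
    by (cases x; simp add: one_bicyclic_def)+
qed

end

definition gen_a :: bicyclic where "gen_a = AB 1 0"
definition gen_b :: bicyclic where "gen_b = AB 0 1"

lemma gen_b_gen_a: "gen_b * gen_a = 1"
  by (simp add: gen_a_def gen_b_def one_bicyclic_def)

lemma gen_a_power: "gen_a ^ i = AB i 0"
  by (induction i) (simp_all add: gen_a_def one_bicyclic_def)

lemma gen_b_power: "gen_b ^ j = AB 0 j"
  by (induction j) (simp_all add: gen_b_def one_bicyclic_def)

lemma AB_eq: "AB i j = gen_a ^ i * gen_b ^ j"
  by (simp add: gen_a_power gen_b_power)

lemma cancel_powers: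
  fixes x y :: "'a::monoid_mult"
  assumes "y * x = 1"
  shows "y ^ l * x ^ m = x ^ (m - l) * y ^ (l - m)"
proof (induction l arbitrary: m)
  case 0
  then show ?case by simp
next
  case (Suc l)
  show ?case
  proof (cases m)
    case 0
    then show ?thesis by simp
  next
    case (Suc k)
    have "y ^ Suc l * x ^ Suc k = y ^ l * (y * x) * x ^ k"
      by (simp only: power_Suc2[of y l] power_Suc[of x k] mult.assoc)
    then show ?thesis
      using Suc Suc.IH assms by simp
  qed
qed

lemma bicyclic_presentation:
  fixes x y :: "'a::monoid_mult"
  assumes "y * x = 1"
  shows "\<exists>!f :: bicyclic \<Rightarrow> 'a.
           f 1 = 1 \<and> (\<forall>u v. f (u * v) = f u * f v) \<and> f gen_a = x \<and> f gen_b = y"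
proof (rule ex1I)
  let ?f = "\<lambda>u. case u of AB i j \<Rightarrow> x ^ i * y ^ j"
  have "?f (AB k l * AB m n) = ?f (AB k l) * ?f (AB m n)" for k l m n
  proof -
    have "max l m - l = m - l" "max l m - m = l - m"
      by auto
    then have "?f (AB k l * AB m n) = x ^ k * (x ^ (m - l) * y ^ (l - m)) * y ^ n"
      by (simp add: power_add mult.assoc add.commute[of n])
    also have "\<dots> = x ^ k * (y ^ l * x ^ m) * y ^ n"
      by (simp only: cancel_powers[OF assms])
    finally show ?thesis
      by (simp add: mult.assoc)
  qed
  then have "?f (u * v) = ?f u * ?f v" for u v
    by (metis bicyclic.exhaust)
  then show "?f 1 = 1 \<and> (\<forall>u v. ?f (u * v) = ?f u * ?f v) \<and> ?f gen_a = x \<and> ?f gen_b = y"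
    by (simp add: one_bicyclic_def gen_a_def gen_b_def)
next
  fix g :: "bicyclic \<Rightarrow> 'a"
  assume g: "g 1 = 1 \<and> (\<forall>u v. g (u * v) = g u * g v) \<and> g gen_a = x \<and> g gen_b = y"
  then have pow: "g (u ^ n) = g u ^ n" for u n
    by (induction n) auto
  show "g = (\<lambda>u. case u of AB i j \<Rightarrow> x ^ i * y ^ j)"
  proof
    fix u
    show "g u = (case u of AB i j \<Rightarrow> x ^ i * y ^ j)"
    proof (cases u)
      case (AB i j)
      have "g (gen_a ^ i * gen_b ^ j) = x ^ i * y ^ j"
        using g pow by simp
      then show ?thesis
        unfolding AB by (simp flip: AB_eq)
    qed
  qed
qed

lemma bicyclic_inverse_iff:
  "AB i j * y * AB i j = AB i j \<and> y * AB i j * y = y \<longleftrightarrow> y = AB j i"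
  by (cases y) (auto simp: max_def split: if_splits)

instance bicyclic :: inverse_semigroup
proof
  fix x :: bicyclic
  show "\<exists>!y. x * y * x = x \<and> y * x * y = y"
    by (cases x) (simp only: bicyclic_inverse_iff, simp)
qed

lemma sinv_AB: "sinv (AB i j) = AB j i"
  unfolding sinv_def by (simp only: bicyclic_inverse_iff the_eq_trivial)


section \<open>Two-sided subsemigroups of the first form\<close>

definition R1 :: "bicyclic set" where
  "R1 = {AB 0 j | j. True}"

lemma R1_eq_R_class_one: "R1 = {x. range ((*) x) = range ((*) 1)}"
proof -
  have "range ((*) (AB i j)) = UNIV \<longleftrightarrow> i = 0" for i j
  proof
    assume "range ((*) (AB i j)) = UNIV"
    then obtain y where "AB i j * y = AB 0 0"
      by (metis surjD)
    then show "i = 0"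
      by (cases y) (auto simp: max_def split: if_splits)
  next
    assume "i = 0"
    have "AB 0 j * AB (j + k) l = AB k l" for k l
      by simp
    then have "\<exists>y. z = AB 0 j * y" for z
      by (cases z) metis
    with \<open>i = 0\<close> show "range ((*) (AB i j)) = UNIV"
      by blast
  qed
  moreover have "range ((*) (1::bicyclic)) = UNIV"
    by simp
  ultimately show ?thesis
    unfolding R1_def using bicyclic.exhaust by (smt (verit) Collect_cong)
qed

definition Diag :: "bicyclic set" where
  "Diag = {AB i i | i. True}"

definition Lset :: "nat \<Rightarrow> bicyclic set" where
  "Lset q = {AB i j | i j. j \<le> q}"

definition Tset :: "nat \<Rightarrow> nat \<Rightarrow> bicyclic set" where
  "Tset q p = {AB i j | i j. q \<le> i \<and> i \<le> j \<and> j < p}"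

definition Lambda :: "nat set \<Rightarrow> nat \<Rightarrow> nat \<Rightarrow> bicyclic set" where
  "Lambda I p d = {AB i j | i j. i \<in> I \<and> int d dvd int j - int i \<and> j \<ge> p}"

definition Sigma_set :: "nat \<Rightarrow> nat \<Rightarrow> nat set \<Rightarrow> bicyclic set" where
  "Sigma_set p d P = {AB (p + r + u * d) (p + r + v * d) | r u v. r \<in> P}"

text \<open>If \<open>q = p\<close> then \<open>{q..<p}\<close> is empty, so \<open>I = {}\<close> and \<open>q \<in> I\<close> cannot hold. This degenerate
  case is part of the family: the bicyclic monoid itself arises only from \<open>q = p = 0\<close>, \<open>I = {}\<close>,
  \<open>d = 1\<close>, \<open>P = {0}\<close>. Hence \<open>q \<in> I\<close> is required exactly when \<open>q < p\<close>.\<close>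

definition two_sided_first_form ::
  "nat \<Rightarrow> nat \<Rightarrow> nat \<Rightarrow> nat set \<Rightarrow> nat set \<Rightarrow> bicyclic set \<Rightarrow> bicyclic set \<Rightarrow> bicyclic set \<Rightarrow> bool"
where
  "two_sided_first_form q p d I P F\<^sub>D F S \<longleftrightarrow>
     q \<le> p \<and> d > 0 \<and>
     I \<subseteq> {q..<p} \<and> (q < p \<longrightarrow> q \<in> I) \<and>
     P \<subseteq> {..<d} \<and> 0 \<in> P \<and>
     F\<^sub>D \<subseteq> Diag \<inter> Lset q \<and> F \<subseteq> Tset q p \<and>
     S = F\<^sub>D \<union> F \<union> Lambda I p d \<union> Sigma_set p d P \<and>
     subsemigroup S"

end

theory Submission
  imports Defs
begin

text \<open>If \<open>b\<^sup>n = s\<^sup>-\<^sup>1 t\<close> then \<open>s\<close> has the form \<open>a\<^sup>i\<close>. When \<open>p > 0\<close>, the only such element that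
  \<open>S\<close> can contain is \<open>1\<close>, so \<open>t = b\<^sup>n\<close> lies in \<open>S\<close>. When \<open>p = 0\<close>, the map
  \<open>a\<^sup>i b\<^sup>j \<mapsto> j - i\<close> is a homomorphism sending \<open>S\<close> into the multiples of \<open>d\<close>; writing \<open>b\<close> as a
  quotient forces \<open>d = 1\<close>, and then \<open>S\<close> is the whole monoid.\<close>

text \<open>\<open>a^i b^j\<close> is the quotient of \<open>b^i\<close> and \<open>b^j\<close>,
  both in \<open>R1\<close>, because the inverse of \<open>b^i\<close> is
  \<open>a^i\<close>.\<close>

lemma left_I_order_if_R1_subset:
  assumes "subsemigroup S" "R1 \<subseteq> S"
  shows "left_I_order S"
  unfolding left_I_order_def
proof (intro conjI allI)
  fix x
  obtain i j where "x = AB i j"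
    by (cases x)
  then have "x = sinv (AB 0 i) * AB 0 j"
    by (simp add: sinv_AB)
  moreover have "AB 0 i \<in> S" "AB 0 j \<in> S"
    using assms(2) by (auto simp: R1_def)
  ultimately show "\<exists>s\<in>S. \<exists>t\<in>S. x = sinv s * t"
    by blast
qed (fact assms(1))

text \<open>Turns a quotient representation of \<open>AB m n\<close> into linear arithmetic on
  exponents.\<close>

lemma left_I_orderE:
  assumes "left_I_order S"
  obtains i j k l where "AB i j \<in> S" "AB k l \<in> S"
    "m = j + (max i k - i)" "n = l + (max i k - k)"
proof -
  obtain s t where "s \<in> S" "t \<in> S" "AB m n = sinv s * t"
    using assms unfolding left_I_order_def by blast
  moreover obtain i j k l where "s = AB i j" "t = AB k l"
    by (metis bicyclic.exhaust)
  ultimately show thesis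
    using that[of i j k l] by (simp add: sinv_AB)
qed

lemma R1_subset_if_left_I_order:
  assumes "left_I_order S" and "\<And>i. AB i 0 \<in> S \<Longrightarrow> i = 0"
  shows "R1 \<subseteq> S"
proof
  fix x assume "x \<in> R1"
  then obtain n where x: "x = AB 0 n"
    by (auto simp: R1_def)
  obtain i j k l where ijkl: "AB i j \<in> S" "AB k l \<in> S"
      "0 = j + (max i k - i)" "n = l + (max i k - k)"
    using assms(1) by (rule left_I_orderE)
  then have "j = 0"
    by linarith
  with ijkl(1) have "i = 0"
    using assms(2) by simp
  \<comment> \<open>With \<open>i = j = 0\<close> the first equation forces \<open>k = 0\<close>,
    hence \<open>l = n\<close> and \<open>x\<close> is \<open>AB k l\<close> itself.\<close>
  with ijkl show "x \<in> S"
    by (simp add: x)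
qed

lemma left_I_order_modulus_1:
  assumes "left_I_order S" and "\<And>i j. AB i j \<in> S \<Longrightarrow> int d dvd int j - int i"
  shows "d = 1"
proof -
  obtain i j k l where ijkl: "AB i j \<in> S" "AB k l \<in> S"
      "0 = j + (max i k - i)" "1 = l + (max i k - k)"
    using assms(1) by (rule left_I_orderE)
  then have "int d dvd (int l - int k) - (int j - int i)"
    by (intro dvd_diff assms(2))
  \<comment> \<open>Inversion negates the exponent difference, so the left side is the difference of
    the quotient \<open>AB 0 1\<close>.\<close>
  moreover have "(int l - int k) - (int j - int i) = 1"
    using ijkl by linarith
  ultimately show ?thesis
    by simp
qed

text \<open>\<open>Lambda\<close> and \<open>Sigma_set\<close> only have second exponents at least
  \<open>p\<close>, hence positive; in \<open>F\<^sub>D\<close> and \<open>F\<close> the first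
  exponent is at most the second.\<close>

lemma AB_0_in_first_form:
  assumes "two_sided_first_form q p d I P F\<^sub>D F S" "p > 0" "AB i 0 \<in> S"
  shows "i = 0"
  using assms
  by (auto simp: two_sided_first_form_def Diag_def Tset_def Lambda_def Sigma_set_def)

text \<open>For \<open>p = 0\<close> both \<open>Tset q p\<close> and \<open>I\<close> are empty, so
  only diagonal elements and \<open>Sigma_set\<close> remain.\<close>

lemma first_form_0_dvd:
  assumes "two_sided_first_form q 0 d I P F\<^sub>D F S" "AB i j \<in> S"
  shows "int d dvd int j - int i"
proof -
  consider "i = j" | r u v where "i = r + u * d" "j = r + v * d"
    using assms unfolding two_sided_first_form_def
    by (auto simp: Diag_def Tset_def Lambda_def Sigma_set_def)
  then show ?thesis
    by cases (auto simp flip: left_diff_distrib)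
qed

lemma first_form_0_1_eq_UNIV:
  assumes "two_sided_first_form q 0 1 I P F\<^sub>D F S"
  shows "S = UNIV"
proof -
  have "0 \<in> P" and Sigma: "Sigma_set 0 1 P \<subseteq> S"
    using assms by (auto simp: two_sided_first_form_def)
  have "AB i j \<in> Sigma_set 0 1 P" for i j
  proof -
    \<comment> \<open>Instance \<open>r = 0\<close>, \<open>u = i\<close>, \<open>v = j\<close> of
      the elements of \<open>Sigma_set\<close>.\<close>
    have "AB i j = AB (0 + 0 + i * 1) (0 + 0 + j * 1)"
      by simp
    then show ?thesis
      unfolding Sigma_set_def using \<open>0 \<in> P\<close> by blast
  qed
  then have "x \<in> Sigma_set 0 1 P" for x
    by (cases x) simp
  with Sigma show ?thesis
    by blast
qed

theorem corollary5p3: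
  fixes q p d :: nat and I P :: "nat set" and F\<^sub>D F S :: "bicyclic set"
  assumes "two_sided_first_form q p d I P F\<^sub>D F S"
    and "S \<noteq> UNIV"
  shows "left_I_order S \<longleftrightarrow> R1 \<subseteq> S"
proof
  assume L: "left_I_order S"
  have "p > 0"
  proof (rule ccontr)
    assume "\<not> p > 0"
    then have form: "two_sided_first_form q 0 d I P F\<^sub>D F S"
      using assms(1) by simp
    with L have "d = 1"
      using left_I_order_modulus_1 first_form_0_dvd by blast
    with form assms(2) show False
      using first_form_0_1_eq_UNIV by blast
  qed
  with L show "R1 \<subseteq> S"
    using R1_subset_if_left_I_order AB_0_in_first_form[OF assms(1)] by blast
next
  assume "R1 \<subseteq> S"
  with assms(1) show "left_I_order S"
    by (auto simp: two_sided_first_form_def intro: left_I_order_if_R1_subset)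
qed

end
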